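(* The map $f_\lambda(z)=f(\lambda z)$ has an attracting fixed point at $x_0$ of multiplier $-\lambda$. Moreover $f_\lambda$ exchanges the two sets $W_+$ and $W_-$, i.e. $f_\lambda(W_+)=W_-$ and $f_\lambda(W_-)=W_+$.
   Context: Let $\ell\geq 2$ be an even integer. Let $f$ be the real analytic function which near $0$ coincides with the real fixed point of period-doubling renormalization with critical point of degree $\ell$. With $\lambda=-f(f(0))\in(0,1)$, it satisfies the Cvitanović–Feigenbaum equation: $f(z)=-\frac1\lambda f(f(\lambda z))$ near $0$; $f(0)=1$; and $f(z)=F(z^\ell)$, where $F^{-1}$ is defined and univalent on $\mathbb C_\lambda=\mathbb C\setminus(]-\infty,-1/\lambda]\cup[1/\lambda^2,+\infty[)$. Put $\mathcal W=F^{-1}(\mathbb C_\lambda)$ and $W=\{z\in\mathbb C: z^\ell\in\mathcal W\}$, so that $f(z)=F(z^\ell)$ is defined on $W$ with $f:W\to\mathbb C_\lambda$. Put $W_+=W\cap\{z: 0<\operatorname{Arg}(z)<\pi/\ell\}$ and $W_-=W\cap\{z: -\pi/\ell<\operatorname{Arg}(z)<0\}$. The point $x_0$ is the first positive preimage of $0$ by $f$ (the smallest positive real zero of $f$). *)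

theory Defs
  imports "HOL-Complex_Analysis.Complex_Analysis"
begin

definition real_analytic_on :: "(real \<Rightarrow> real) \<Rightarrow> real set \<Rightarrow> bool" where
  "real_analytic_on \<phi> S \<longleftrightarrow> (\<forall>x\<in>S. \<exists>P. (\<lambda>h. \<phi> (x + h)) has_fps_expansion P)"

text \<open>
  Real analytic unimodal maps of the interval \<open>[-1, 1]\<close> whose critical point \<open>0\<close> has degree
  \<open>l\<close>, normalized by \<open>g 0 = 1\<close>. Only even \<open>l\<close> is intended, so that \<open>x ^ l\<close> is
  \<open>\<bar>x\<bar> ^ l\<close>. Values of \<open>g\<close> outside \<open>[-1, 1]\<close> are irrelevant throughout.
\<close>

definition unimodal_degree :: "nat \<Rightarrow> (real \<Rightarrow> real) \<Rightarrow> bool" where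
  "unimodal_degree l g \<longleftrightarrow>
     g 0 = 1 \<and> g ` {-1..1} \<subseteq> {-1..1} \<and>
     (\<exists>\<phi>. real_analytic_on \<phi> {0..1} \<and> (\<forall>u\<in>{0..1}. deriv \<phi> u < 0) \<and>
          (\<forall>x\<in>{-1..1}. g x = \<phi> (x ^ l)))"

definition pd_scale :: "(real \<Rightarrow> real) \<Rightarrow> real" where
  "pd_scale g = - g (g 0)"

definition pd_renormalizable :: "(real \<Rightarrow> real) \<Rightarrow> bool" where
  "pd_renormalizable g \<longleftrightarrow>
     (let I = {- pd_scale g..pd_scale g} in
        0 < pd_scale g \<and> pd_scale g < 1 \<and> g ` I \<inter> I = {} \<and> g ` g ` I \<subseteq> I)"

definition pd_renormalization :: "(real \<Rightarrow> real) \<Rightarrow> real \<Rightarrow> real" where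
  "pd_renormalization g x = - (1 / pd_scale g) * g (g (pd_scale g * x))"

text \<open>
  The last clause is the Cvitanovic-Feigenbaum equation. For even \<open>l\<close> such a \<open>g\<close> is
  known to be unique on \<open>[-1, 1]\<close>.
\<close>

definition pd_fixed_point :: "nat \<Rightarrow> (real \<Rightarrow> real) \<Rightarrow> bool" where
  "pd_fixed_point l g \<longleftrightarrow>
     unimodal_degree l g \<and> pd_renormalizable g \<and>
     (\<forall>x\<in>{-1..1}. pd_renormalization g x = g x)"

definition slit_plane :: "real \<Rightarrow> complex set" where
  "slit_plane lam =
     - (complex_of_real ` {..- (1 / lam)} \<union> complex_of_real ` {1 / lam ^ 2..})"

text \<open>
  The given datum is \<open>Finv\<close>, the inverse of \<open>F\<close> on the slit plane; \<open>F\<close> itself is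
  recovered from it. Outside \<open>calW\<close> (respectively \<open>dom_W\<close>) the values of \<open>map_F\<close>
  (respectively \<open>map_f\<close>) are meaningless.
\<close>

definition calW :: "real \<Rightarrow> (complex \<Rightarrow> complex) \<Rightarrow> complex set" where
  "calW lam Finv = Finv ` slit_plane lam"

definition map_F :: "real \<Rightarrow> (complex \<Rightarrow> complex) \<Rightarrow> complex \<Rightarrow> complex" where
  "map_F lam Finv = inv_into (slit_plane lam) Finv"

definition dom_W :: "nat \<Rightarrow> real \<Rightarrow> (complex \<Rightarrow> complex) \<Rightarrow> complex set" where
  "dom_W l lam Finv = {z. z ^ l \<in> calW lam Finv}"

definition map_f :: "nat \<Rightarrow> real \<Rightarrow> (complex \<Rightarrow> complex) \<Rightarrow> complex \<Rightarrow> complex" where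
  "map_f l lam Finv z = map_F lam Finv (z ^ l)"

definition map_f_scaled :: "nat \<Rightarrow> real \<Rightarrow> (complex \<Rightarrow> complex) \<Rightarrow> complex \<Rightarrow> complex" where
  "map_f_scaled l lam Finv z = map_f l lam Finv (complex_of_real lam * z)"

definition univalent_on :: "(complex \<Rightarrow> complex) \<Rightarrow> complex set \<Rightarrow> bool" where
  "univalent_on h S \<longleftrightarrow> h holomorphic_on S \<and> inj_on h S"

definition extends_near_0 ::
    "nat \<Rightarrow> real \<Rightarrow> (complex \<Rightarrow> complex) \<Rightarrow> (real \<Rightarrow> real) \<Rightarrow> bool" where
  "extends_near_0 l lam Finv g \<longleftrightarrow>
     (\<forall>\<^sub>F x in nhds (0::real).
        complex_of_real x \<in> dom_W l lam Finv \<and>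
        map_f l lam Finv (complex_of_real x) = complex_of_real (g x))"

definition W_plus :: "nat \<Rightarrow> real \<Rightarrow> (complex \<Rightarrow> complex) \<Rightarrow> complex set" where
  "W_plus l lam Finv = dom_W l lam Finv \<inter> {z. 0 < Arg z \<and> Arg z < pi / real l}"

definition W_minus :: "nat \<Rightarrow> real \<Rightarrow> (complex \<Rightarrow> complex) \<Rightarrow> complex set" where
  "W_minus l lam Finv = dom_W l lam Finv \<inter> {z. - (pi / real l) < Arg z \<and> Arg z < 0}"

text \<open>
  \<open>LEAST\<close> on the reals is a definite description: a statement about \<open>first_zero\<close> carries
  information only once a smallest positive zero has been shown to exist.
\<close>

definition first_zero :: "nat \<Rightarrow> real \<Rightarrow> (complex \<Rightarrow> complex) \<Rightarrow> real" where
  "first_zero l lam Finv =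
     (LEAST x. 0 < x \<and> complex_of_real x \<in> dom_W l lam Finv \<and>
               map_f l lam Finv (complex_of_real x) = 0)"

definition attracting_fixed_point :: "(complex \<Rightarrow> complex) \<Rightarrow> complex \<Rightarrow> complex \<Rightarrow> bool" where
  "attracting_fixed_point h p m \<longleftrightarrow>
     h analytic_on {p} \<and> h p = p \<and> deriv h p = m \<and> norm m < 1"

end

theory Submission
  imports Defs
begin

text \<open>
  With \<open>G\<close> the inverse of \<open>F\<close> and \<open>R\<close> the principal \<open>l\<close>-th root, the
  Cvitanovic-Feigenbaum equation reads \<open>G (R (G (- lam w))) = lam ^ l G w\<close> for real
  \<open>w \<in> (- lam, 1)\<close>. Both sides are holomorphic on the plane slit along
  \<open>(- \<infinity>, - lam]\<close> and \<open>[1, \<infinity>)\<close>, so the identity persists there; it says that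
  \<open>z \<mapsto> f (lam z)\<close> is conjugate to \<open>w \<mapsto> - lam w\<close> by \<open>R \<circ> G\<close>. The fixed point
  \<open>0\<close> of the latter is carried to \<open>x0\<close>. As \<open>F\<close> is real and decreasing, \<open>G\<close>
  interchanges the half-planes, so \<open>R \<circ> G\<close> maps the lower one onto \<open>W_plus\<close> and the upper
  one onto \<open>W_minus\<close>, while \<open>w \<mapsto> - lam w\<close> interchanges them.
\<close>

section \<open>Complex extension of real analytic functions\<close>

text \<open>The same coefficients read as complex numbers have the same norms, so the complex series
  converges on a disc of the same radius; on real arguments its sum is the real sum.\<close>

lemma fps_expansion_of_real:
  fixes P :: "real fps"
  assumes P: "f has_fps_expansion P"
  obtains r \<Psi> where "0 < r" "\<Psi> holomorphic_on ball 0 r"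
    "\<And>x. \<bar>x\<bar> < r \<Longrightarrow> \<Psi> (complex_of_real x) = complex_of_real (f x)"
proof -
  define Q where "Q = Abs_fps (\<lambda>n. complex_of_real (fps_nth P n))"
  have conv: "fps_conv_radius Q = fps_conv_radius P"
    unfolding fps_conv_radius_def Q_def by (rule conv_radius_cong) simp
  have pos: "fps_conv_radius P > 0" and ev: "\<forall>\<^sub>F x in nhds 0. eval_fps P x = f x"
    using P by (auto simp: has_fps_expansion_def)
  obtain d where d: "d > 0" "\<And>x. \<bar>x\<bar> < d \<Longrightarrow> eval_fps P x = f x"
    using ev by (auto simp: eventually_nhds_metric dist_real_def)
  obtain e where e: "0 < e" "ereal e < fps_conv_radius P"
    using ereal_dense2[OF pos] by (auto simp: zero_ereal_def)
  define r where "r = min d e"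
  have r: "0 < r" "r \<le> d" "r \<le> e"
    using d e by (auto simp: r_def)
  have small: "ereal s < fps_conv_radius P" if "s < r" for s
    by (rule less_trans[OF _ e(2)]) (use that r in simp)
  show thesis
  proof
    show "0 < r" by fact
    show "eval_fps Q holomorphic_on ball 0 r"
      by (rule holomorphic_on_eval_fps) (use small in \<open>auto simp: conv\<close>)
    fix x :: real assume x: "\<bar>x\<bar> < r"
    have "summable (\<lambda>n. fps_nth P n * x ^ n)"
      by (rule summable_fps) (use x small in simp)
    then have "eval_fps Q (of_real x) = of_real (eval_fps P x)"
      unfolding eval_fps_def Q_def by (subst suminf_of_real) auto
    with d(2)[of x] x r show "eval_fps Q (of_real x) = of_real (f x)" by simp
  qed
qed

lemma real_analytic_onD:
  assumes "real_analytic_on \<phi> S" "x \<in> S"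
  obtains r \<Phi> where "0 < r" "\<Phi> holomorphic_on ball (complex_of_real x) r"
    "\<And>y. \<bar>y - x\<bar> < r \<Longrightarrow> \<Phi> (complex_of_real y) = complex_of_real (\<phi> y)"
proof -
  obtain P where "(\<lambda>h. \<phi> (x + h)) has_fps_expansion P"
    using assms by (auto simp: real_analytic_on_def)
  then obtain r \<Psi> where r: "0 < r" "\<Psi> holomorphic_on ball 0 r"
    "\<And>h. \<bar>h\<bar> < r \<Longrightarrow> \<Psi> (complex_of_real h) = complex_of_real (\<phi> (x + h))"
    by (rule fps_expansion_of_real) blast
  have "(\<Psi> \<circ> (\<lambda>z. z - of_real x)) holomorphic_on ball (of_real x) r"
    by (rule holomorphic_on_compose_gen[OF _ r(2)])
       (auto intro!: holomorphic_intros simp: dist_norm norm_minus_commute)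
  moreover have "(\<Psi> \<circ> (\<lambda>z. z - of_real x)) (of_real y) = of_real (\<phi> y)" if "\<bar>y - x\<bar> < r" for y
    using r(3)[OF that] by simp
  ultimately show thesis
    using that r(1) by blast
qed

text \<open>Expansions are two-sided even at the end points of \<open>S\<close>, so
  \<open>deriv\<close> is a genuine two-sided derivative throughout \<open>S\<close>, and sign
  conditions on it have content.\<close>

lemma real_analytic_on_imp_DERIV:
  assumes "real_analytic_on \<phi> S" "x \<in> S"
  shows "(\<phi> has_real_derivative deriv \<phi> x) (at x)"
proof -
  obtain P where P: "(\<lambda>h. \<phi> (x + h)) has_fps_expansion P"
    using assms by (auto simp: real_analytic_on_def)
  have "(eval_fps P has_real_derivative eval_fps (fps_deriv P) 0) (at 0)"
    using P by (intro has_field_derivative_eval_fps) (auto simp: has_fps_expansion_def zero_ereal_def)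
  moreover have "\<forall>\<^sub>F h in nhds 0. eval_fps P h = \<phi> (x + h)"
    using P by (auto simp: has_fps_expansion_def)
  ultimately have "((\<lambda>h. \<phi> (x + h)) has_real_derivative eval_fps (fps_deriv P) 0) (at 0)"
    by (subst DERIV_cong_ev[OF refl _ refl, symmetric])
  then have "(\<phi> has_real_derivative eval_fps (fps_deriv P) 0) (at x)"
    using DERIV_shift[of \<phi> _ 0 x] by (simp add: add.commute)
  then show ?thesis
    using DERIV_imp_deriv by metis
qed

text \<open>On a small disc around \<open>s\<close> the holomorphic extension \<Phi> of \<phi> takes
  values in \<open>T\<close>, so \<open>G (\<Phi> z) - z\<close> is holomorphic there. If its zeros
  accumulate at a real point \<open>x\<close> of the disc, it vanishes at every real
  \<open>y\<close> of the disc. The two points \<open>x\<close>, \<open>y\<close> give the form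
  needed for an induction along a connected set.\<close>

lemma real_identity_near:
  assumes \<phi>: "real_analytic_on \<phi> S" "s \<in> S"
    and G: "G holomorphic_on T" "open T" "complex_of_real (\<phi> s) \<in> T"
  obtains e where "0 < e"
    "\<And>x y. \<bar>x - s\<bar> < e \<Longrightarrow> \<bar>y - s\<bar> < e \<Longrightarrow>
       \<exists>\<^sub>F t in at x. G (complex_of_real (\<phi> t)) = complex_of_real t \<Longrightarrow>
       G (complex_of_real (\<phi> y)) = complex_of_real y"
proof -
  obtain r \<Phi> where r: "0 < r" and hol: "\<Phi> holomorphic_on ball (complex_of_real s) r"
    and \<Phi>: "\<And>y. \<bar>y - s\<bar> < r \<Longrightarrow> \<Phi> (complex_of_real y) = complex_of_real (\<phi> y)"
    using real_analytic_onD[OF \<phi>] by metis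
  have "open (ball (complex_of_real s) r \<inter> \<Phi> -` T)"
    by (rule continuous_open_preimage) (use hol G holomorphic_on_imp_continuous_on in auto)
  moreover have "complex_of_real s \<in> ball (complex_of_real s) r \<inter> \<Phi> -` T"
    using r \<Phi>[of s] G by simp
  ultimately obtain e where e: "0 < e" "ball (complex_of_real s) e \<subseteq> ball (complex_of_real s) r \<inter> \<Phi> -` T"
    using open_contains_ball by meson
  let ?B = "ball (complex_of_real s) e"
  have inB: "complex_of_real t \<in> ?B \<longleftrightarrow> \<bar>t - s\<bar> < e" for t
    by (simp add: dist_of_real dist_real_def abs_minus_commute)
  have \<Phi>e: "\<Phi> (complex_of_real t) = complex_of_real (\<phi> t)" if "\<bar>t - s\<bar> < e" for t
  proof (rule \<Phi>)
    have "complex_of_real t \<in> ball (complex_of_real s) r"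
      using e(2) that inB by blast
    then show "\<bar>t - s\<bar> < r"
      by (simp add: dist_of_real dist_real_def abs_minus_commute)
  qed
  have holB: "(\<lambda>z. G (\<Phi> z) - z) holomorphic_on ?B"
    using holomorphic_on_compose_gen[OF holomorphic_on_subset[OF hol] G(1), of ?B] e(2)
    by (auto intro!: holomorphic_intros simp: o_def image_subset_iff)
  show thesis
  proof
    show "0 < e" by fact
    fix x y :: real
    assume x: "\<bar>x - s\<bar> < e" and y: "\<bar>y - s\<bar> < e"
      and fr: "\<exists>\<^sub>F t in at x. G (complex_of_real (\<phi> t)) = complex_of_real t"
    define U where "U = complex_of_real ` {t. \<bar>t - s\<bar> < e \<and> G (complex_of_real (\<phi> t)) = complex_of_real t}"
    have lim: "complex_of_real x islimpt U"
      unfolding islimpt_approachable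
    proof (intro allI impI)
      fix d :: real assume "d > 0"
      have "\<forall>\<^sub>F t in at x. \<bar>t - s\<bar> < e \<and> dist t x < d"
      proof (rule eventually_conj)
        have "\<forall>\<^sub>F t in nhds x. t \<in> ball s e"
          by (rule eventually_nhds_in_open) (use x in \<open>auto simp: dist_real_def abs_minus_commute\<close>)
        then show "\<forall>\<^sub>F t in at x. \<bar>t - s\<bar> < e"
          unfolding eventually_at_filter
          by eventually_elim (auto simp: dist_real_def abs_minus_commute)
        show "\<forall>\<^sub>F t in at x. dist t x < d"
          using \<open>d > 0\<close> by (auto simp: eventually_at)
      qed
      then have "\<forall>\<^sub>F t in at x. (\<bar>t - s\<bar> < e \<and> dist t x < d) \<and> t \<noteq> x"
        by (rule eventually_conj) (simp add: eventually_at_filter)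
      from frequently_eventually_conj[OF fr this]
      obtain t where "G (complex_of_real (\<phi> t)) = complex_of_real t" "\<bar>t - s\<bar> < e" "dist t x < d" "t \<noteq> x"
        using frequently_ex by fast
      then show "\<exists>x'\<in>U. x' \<noteq> complex_of_real x \<and> dist x' (complex_of_real x) < d"
        unfolding U_def by (intro bexI[of _ "complex_of_real t"]) (auto simp: dist_of_real)
    qed
    have "G (\<Phi> (complex_of_real y)) - complex_of_real y = 0"
      by (rule analytic_continuation[OF holB _ _ _ _ lim])
         (use x y inB \<Phi>e in \<open>auto simp: U_def\<close>)
    with \<Phi>e[OF y] show "G (complex_of_real (\<phi> y)) = complex_of_real y" by simp
  qed
qed

text \<open>The identity theorem along an interval: the local statement of
  \<open>real_identity_near\<close> is propagated from \<open>a\<close> by connectedness of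
  \<open>{a..b}\<close>.\<close>

lemma left_inverse_real_analytic:
  assumes \<phi>: "real_analytic_on \<phi> {a..b}" and ab: "a < b"
    and G: "G holomorphic_on T" "open T" "\<And>x. x \<in> {a..b} \<Longrightarrow> complex_of_real (\<phi> x) \<in> T"
    and near: "\<forall>\<^sub>F x in at_right a. G (complex_of_real (\<phi> x)) = complex_of_real x"
    and u: "u \<in> {a..b}"
  shows "G (complex_of_real (\<phi> u)) = complex_of_real u"
proof -
  \<comment> \<open>Equality at the single point \<open>x\<close> would not propagate. The inductive
    property is that solutions accumulate at \<open>x\<close>, which at \<open>a\<close> follows
    from the one-sided hypothesis.\<close>
  define P where "P x \<longleftrightarrow> (\<exists>\<^sub>F t in at x. G (complex_of_real (\<phi> t)) = complex_of_real t)" for x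
  have "P u"
  proof (rule connected_induction_simple[of "{a..b}" a u P])
    have "\<exists>\<^sub>F x in at_right a. G (complex_of_real (\<phi> x)) = complex_of_real x"
      by (rule eventually_frequently[OF _ near]) simp
    then show "P a"
      unfolding P_def frequently_def using filter_leD[OF at_le[of "{a<..}" UNIV a]] by blast
  next
    fix s assume s: "s \<in> {a..b}"
    obtain e where e: "0 < e"
      "\<And>x y. \<bar>x - s\<bar> < e \<Longrightarrow> \<bar>y - s\<bar> < e \<Longrightarrow> P x \<Longrightarrow> G (complex_of_real (\<phi> y)) = complex_of_real y"
      using real_identity_near[OF \<phi> s G(1,2) G(3)[OF s]] unfolding P_def by blast
    show "\<exists>T. openin (top_of_set {a..b}) T \<and> s \<in> T \<and> (\<forall>x\<in>T. \<forall>y\<in>T. P x \<longrightarrow> P y)"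
    proof (intro exI conjI ballI impI)
      show "openin (top_of_set {a..b}) ({a..b} \<inter> ball s e)"
        by (rule openin_open_Int) simp
      show "s \<in> {a..b} \<inter> ball s e" using s e by simp
      fix x y assume xy: "x \<in> {a..b} \<inter> ball s e" "y \<in> {a..b} \<inter> ball s e" "P x"
      have "\<forall>\<^sub>F t in nhds y. t \<in> ball s e"
        by (rule eventually_nhds_in_open) (use xy in auto)
      then have "\<forall>\<^sub>F t in at y. G (complex_of_real (\<phi> t)) = complex_of_real t"
        unfolding eventually_at_filter
        by eventually_elim (use e(2)[of x] xy in \<open>auto simp: dist_real_def abs_minus_commute\<close>)
      then show "P y"
        unfolding P_def by (rule eventually_frequently[rotated]) simp
    qed
  qed (use u ab in auto)
  moreover obtain e where "0 < e"
    "\<And>x y. \<bar>x - u\<bar> < e \<Longrightarrow> \<bar>y - u\<bar> < e \<Longrightarrow> P x \<Longrightarrow> G (complex_of_real (\<phi> y)) = complex_of_real y"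
    using real_identity_near[OF \<phi> u G(1,2) G(3)[OF u]] unfolding P_def by blast
  ultimately show ?thesis by (metis abs_zero diff_self)
qed

section \<open>Slit planes and the principal root\<close>

text \<open>Two instances occur: the domain of the inverse of \<open>F\<close>, and the smaller
  \<open>slit (- lam) 1\<close> on which the functional equation is continued.\<close>

definition slit :: "real \<Rightarrow> real \<Rightarrow> complex set" where
  "slit a b = {w. Im w \<noteq> 0 \<or> a < Re w \<and> Re w < b}"

lemma open_slit: "open (slit a b)"
proof -
  have "slit a b = {w. Im w < 0} \<union> {w. 0 < Im w} \<union> ({w. a < Re w} \<inter> {w. Re w < b})"
    by (auto simp: slit_def)
  then show ?thesis
    by (auto intro!: open_Un open_Int open_halfspace_Re_lt open_halfspace_Re_gt
        open_halfspace_Im_lt open_halfspace_Im_gt)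
qed

text \<open>The set is starlike about 0. The point 0 of a segment needs separate treatment, being
  real even when \<open>w\<close> is not.\<close>

lemma connected_slit:
  assumes "a < 0" "0 < b"
  shows "connected (slit a b)"
proof (rule starlike_imp_connected, unfold starlike_def, intro bexI ballI)
  show "0 \<in> slit a b" using assms by (simp add: slit_def)
  fix w assume w: "w \<in> slit a b"
  show "closed_segment 0 w \<subseteq> slit a b"
  proof
    fix z assume "z \<in> closed_segment 0 w"
    then obtain t where t: "0 \<le> t" "t \<le> 1" "z = of_real t * w"
      by (auto simp: in_segment scaleR_conv_of_real)
    have "a < t * x \<and> t * x < b" if "a < x" "x < b" for x
    proof (cases "x \<ge> 0")
      case True
      then have "0 \<le> t * x" "t * x \<le> 1 * x" using t mult_right_mono[of t 1 x] by auto
      then show ?thesis using that assms by simp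
    next
      case False
      then have "t * x \<le> 0" "1 * x \<le> t * x" 
        using t by (auto intro: mult_nonneg_nonpos mult_right_mono_neg)
      then show ?thesis using that assms by simp
    qed
    then show "z \<in> slit a b"
      using w t assms by (cases "t = 0") (auto simp: slit_def)
  qed
qed

lemma slit_plane_eq_slit: "slit_plane lam = slit (- 1 / lam) (1 / lam ^ 2)"
proof -
  have "w \<in> complex_of_real ` A \<longleftrightarrow> Im w = 0 \<and> Re w \<in> A" for w A
    by (auto simp: image_iff complex_eq_iff)
  then show ?thesis
    unfolding slit_plane_def slit_def by auto
qed

text \<open>The principal branch, with argument in \<open>(-pi/l, pi/l]\<close>. As
  \<open>exp\<close> has no zero, this is not a root at \<open>z = 0\<close>, whence the hypotheses
  \<open>z \<noteq> 0\<close> below.\<close>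

definition croot :: "nat \<Rightarrow> complex \<Rightarrow> complex" where
  "croot l z = exp (Ln z / of_nat l)"

lemma croot_power:
  assumes "l > 0" "z \<noteq> 0"
  shows "croot l z ^ l = z"
  using assms by (simp add: croot_def flip: exp_of_nat_mult)

lemma Arg_croot:
  assumes "l > 0" "z \<noteq> 0"
  shows "Arg (croot l z) = Arg z / real l"
proof -
  have "pi * 1 \<le> pi * real l" using assms by (intro mult_left_mono) auto
  moreover have "- pi < Im (Ln z)" "Im (Ln z) \<le> pi"
    using assms by (auto simp: mpi_less_Im_Ln Im_Ln_le_pi)
  ultimately have "- (pi * real l) < Im (Ln z)" "Im (Ln z) \<le> pi * real l"
    by linarith+
  then have "- pi < Im (Ln z) / real l" "Im (Ln z) / real l \<le> pi"
    using assms by (simp_all add: field_simps)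
  then show ?thesis
    using assms by (subst (2) Arg_eq_Im_Ln) (auto simp: croot_def intro!: Arg_exp[THEN trans])
qed

text \<open>In this sector \<open>l * Ln z\<close> still has imaginary part strictly between
  \<open>-pi\<close> and \<open>pi\<close>, so it is the principal logarithm of
  \<open>z ^ l\<close>.\<close>

lemma power_in_sector:
  assumes "l > 0" "z \<noteq> 0" "\<bar>Arg z\<bar> < pi / real l"
  shows "croot l (z ^ l) = z" "Arg (z ^ l) = real l * Arg z"
proof -
  have eq: "z ^ l = exp (of_nat l * Ln z)"
    using assms by (simp add: exp_of_nat_mult)
  have "\<bar>real l * Im (Ln z)\<bar> < pi"
    using assms by (simp add: abs_mult field_simps flip: Arg_eq_Im_Ln)
  then have im: "- pi < Im (of_nat l * Ln z)" "Im (of_nat l * Ln z) \<le> pi"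
    by auto
  show "croot l (z ^ l) = z"
    unfolding croot_def eq using assms im by simp
  show "Arg (z ^ l) = real l * Arg z"
    unfolding eq using assms im by (simp add: Arg_exp Arg_eq_Im_Ln)
qed

lemma croot_of_real_power:
  assumes "l > 0" "x > 0"
  shows "croot l (complex_of_real (x ^ l)) = complex_of_real x"
  using power_in_sector(1)[of l "complex_of_real x"] assms by (simp add: Arg_eq_0[THEN iffD2])

lemma holomorphic_on_croot [holomorphic_intros]:
  assumes "f holomorphic_on S" "\<And>z. z \<in> S \<Longrightarrow> f z \<notin> \<real>\<^sub>\<le>\<^sub>0"
  shows "(\<lambda>z. croot l (f z)) holomorphic_on S"
  unfolding croot_def divide_inverse using assms by (intro holomorphic_intros) auto

text \<open>
  \<open>\<phi>\<close> is the restriction of \<open>F\<close> to \<open>[0, 1]\<close>, so that the real fixed point of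
  renormalization is \<open>x \<mapsto> \<phi> (x ^ l)\<close>.
\<close>

locale cf_inverse =
  fixes l :: nat and lam :: real and \<phi> :: "real \<Rightarrow> real" and G :: "complex \<Rightarrow> complex"
  assumes l: "l \<ge> 2"
    and lam: "0 < lam" "lam < 1"
    and univ: "univalent_on G (slit_plane lam)"
    and analytic: "real_analytic_on \<phi> {0..1}"
    and deriv_neg: "\<And>u. u \<in> {0..1} \<Longrightarrow> deriv \<phi> u < 0"
    and \<phi>_0: "\<phi> 0 = 1"
    and \<phi>_1: "\<phi> 1 = - lam"
    and \<phi>_le: "\<And>u. u \<in> {0..1} \<Longrightarrow> \<bar>\<phi> u\<bar> \<le> 1"
    and \<phi>_pos: "\<And>u. u \<in> {0..lam ^ l} \<Longrightarrow> 0 < \<phi> u"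
    and cf: "\<And>x. x \<in> {0..1} \<Longrightarrow> \<phi> (\<phi> ((lam * x) ^ l) ^ l) = - lam * \<phi> (x ^ l)"
    and near_0: "\<forall>\<^sub>F u in at_right 0. G (complex_of_real (\<phi> u)) = complex_of_real u"
begin

section \<open>The inverse of \<open>F\<close>: reality and exchange of half-planes\<close>

lemma bounds: "- 1 / lam < - 1" "1 < 1 / lam ^ 2"
  using lam by (auto simp: field_simps power_less_one_iff)

lemma open_slit_plane: "open (slit_plane lam)"
  by (simp add: slit_plane_eq_slit open_slit)

lemma connected_slit_plane: "connected (slit_plane lam)"
  unfolding slit_plane_eq_slit using lam by (intro connected_slit) auto

lemma slit_planeI: "Im w \<noteq> 0 \<or> \<bar>Re w\<bar> \<le> 1 \<Longrightarrow> w \<in> slit_plane lam"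
  unfolding slit_plane_eq_slit slit_def using bounds by auto

lemma hol_G: "G holomorphic_on slit_plane lam" and inj_G: "inj_on G (slit_plane lam)"
  using univ by (auto simp: univalent_on_def)

lemma \<phi>_DERIV: "u \<in> {0..1} \<Longrightarrow> (\<phi> has_real_derivative deriv \<phi> u) (at u)"
  using real_analytic_on_imp_DERIV[OF analytic] .

lemma \<phi>_continuous: "continuous_on {0..1} \<phi>"
  using \<phi>_DERIV by (meson DERIV_continuous continuous_at_imp_continuous_on)

text \<open>The identity is given only just to the right of 0 and is continued along
  \<open>{0..1}\<close>; the bound on \<phi> by 1 keeps its values off both slits.\<close>

lemma G_\<phi>: "u \<in> {0..1} \<Longrightarrow> G (complex_of_real (\<phi> u)) = complex_of_real u"
  by (rule left_inverse_real_analytic[OF analytic _ hol_G open_slit_plane _ near_0])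
     (use \<phi>_le in \<open>auto intro!: slit_planeI\<close>)

lemma \<phi>_surj:
  assumes "- lam \<le> x" "x \<le> 1"
  obtains u where "u \<in> {0..1}" "\<phi> u = x"
  using IVT2'[of \<phi> 1 x 0] \<phi>_0 \<phi>_1 \<phi>_continuous assms by auto

text \<open>Every point of \<open>{- lam..1}\<close> is a value of \<phi>, so \<open>G\<close> is
  real there by \<open>G_\<phi>\<close>. Hence \<open>G\<close> and
  \<open>cnj \<circ> G \<circ> cnj\<close> agree on this segment, and so on the connected slit
  plane.\<close>

lemma G_cnj:
  assumes "w \<in> slit_plane lam"
  shows "G (cnj w) = cnj (G w)"
proof -
  have "cnj z \<in> slit_plane lam \<longleftrightarrow> z \<in> slit_plane lam" for z
    by (simp add: slit_plane_eq_slit slit_def)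
  then have "cnj ` slit_plane lam = slit_plane lam"
    by (intro equalityI subsetI) (auto, metis complex_cnj_cnj imageI)
  then have hol: "(\<lambda>w. G w - (cnj \<circ> G \<circ> cnj) w) holomorphic_on slit_plane lam"
    using hol_G holomorphic_on_compose_cnj_cnj[of G "slit_plane lam"] open_slit_plane
    by (intro holomorphic_on_diff) (auto simp del: o_apply)
  have "0 islimpt {- lam..1}"
    using lam by (simp add: islimpt_Icc)
  then have lim: "complex_of_real 0 islimpt complex_of_real ` {- lam..1}"
    by (rule islimpt_isCont_image)
       (auto simp: eventually_at_filter intro!: continuous_intros)
  have "G w - (cnj \<circ> G \<circ> cnj) w = 0"
  proof (rule analytic_continuation[OF hol open_slit_plane connected_slit_plane _ _ lim])
    show "complex_of_real ` {- lam..1} \<subseteq> slit_plane lam"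
      using lam by (auto intro!: slit_planeI)
    fix z assume "z \<in> complex_of_real ` {- lam..1}"
    then obtain u where "u \<in> {0..1}" "z = complex_of_real (\<phi> u)"
      using \<phi>_surj by (metis atLeastAtMost_iff imageE)
    then show "G z - (cnj \<circ> G \<circ> cnj) z = 0"
      using G_\<phi> by simp
  qed (use assms in \<open>auto intro: slit_planeI\<close>)
  then show ?thesis
    by (metis complex_cnj_cnj eq_iff_diff_eq_0 o_apply)
qed

text \<open>If \<open>G w\<close> is real, then \<open>G (cnj w) = G w\<close>, and injectivity
  makes \<open>w\<close> real.\<close>

lemma Im_G_eq_0: 
  assumes "w \<in> slit_plane lam"
  shows "Im (G w) = 0 \<longleftrightarrow> Im w = 0"
proof -
  have "cnj w \<in> slit_plane lam"
    using assms by (auto simp: slit_plane_eq_slit slit_def)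
  then have "cnj (G w) = G w \<longleftrightarrow> cnj w = w"
    using inj_onD[OF inj_G] assms G_cnj by metis
  then show ?thesis by (auto simp: complex_eq_iff)
qed

text \<open>At the real point \<open>\<phi> (1/2)\<close> the derivative of \<open>G\<close> is
  \<open>1 / deriv \<phi> (1/2)\<close>, real and negative. Moving from there in the direction \<i>
  makes \<open>Im G\<close> negative. Any interior point of the interval would do.\<close>

lemma Im_G_neg_somewhere: "\<exists>w. Im w > 0 \<and> Im (G w) < 0"
proof -
  let ?w = "complex_of_real (\<phi> (1/2))"
  have "?w \<in> slit_plane lam" using \<phi>_le[of "1/2"] by (auto intro!: slit_planeI)
  then have G': "(G has_field_derivative deriv G ?w) (at ?w)"
    using hol_G open_slit_plane holomorphic_derivI by blast
  have G\<phi>': "((\<lambda>t. G (complex_of_real (\<phi> t))) has_vector_derivative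
          deriv G ?w * of_real (deriv \<phi> (1/2))) (at (1/2))"
    using field_vector_diff_chain_at[of "\<lambda>t. complex_of_real (\<phi> t)", OF _ G']
      has_vector_derivative_of_real[OF \<phi>_DERIV[of "1/2"]]
    by (simp add: o_def mult.commute)
  have "(complex_of_real has_vector_derivative deriv G ?w * of_real (deriv \<phi> (1/2))) (at (1/2))"
    by (rule has_vector_derivative_transform_within_open[OF G\<phi>', of "{0<..<1}"]) (auto simp: G_\<phi>)
  moreover have "(complex_of_real has_vector_derivative 1) (at (1/2))"
    using has_vector_derivative_of_real[OF DERIV_ident] by simp
  \<comment> \<open>On \<open>{0<..<1}\<close> the curve \<open>t \<mapsto> G (\<phi> t)\<close> is
    the inclusion of the reals, which has derivative 1.\<close>
  ultimately have one: "deriv G ?w * of_real (deriv \<phi> (1/2)) = 1"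
    using vector_derivative_unique_at by blast
  have neg: "deriv \<phi> (1/2) < 0" by (rule deriv_neg) simp
  then have "deriv G ?w = of_real (1 / deriv \<phi> (1/2))"
    using one by (simp add: field_simps)
  then have ReG: "Re (deriv G ?w) < 0" using neg by simp
  have "((\<lambda>t. ?w + \<i> * complex_of_real t) has_vector_derivative \<i>) (at 0)"
    by (auto intro!: derivative_eq_intros)
  then have "((\<lambda>t. G (?w + \<i> * complex_of_real t)) has_vector_derivative \<i> * deriv G ?w) (at 0)"
    using field_vector_diff_chain_at[of "\<lambda>t. ?w + \<i> * complex_of_real t" \<i> 0 G] G'
    by (simp add: o_def)
  then have "((\<lambda>t. Im (G (?w + \<i> * complex_of_real t))) has_real_derivative Re (deriv G ?w)) (at 0)"
    by (simp add: has_vector_derivative_complex_iff)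
  then obtain d where d: "d > 0" "\<And>h. 0 < h \<Longrightarrow> h < d \<Longrightarrow> 
      Im (G (?w + \<i> * complex_of_real h)) < Im (G ?w)"
    using DERIV_neg_dec_right[OF _ ReG] by force
  then have "Im (G (?w + \<i> * complex_of_real (d/2))) < 0"
    using d(2)[of "d/2"] G_\<phi>[of "1/2"] by simp
  then show ?thesis
    using d(1) by (intro exI[of _ "?w + \<i> * complex_of_real (d/2)"]) simp
qed

text \<open>\<open>Im G\<close> has no zero on the connected upper half-plane, so its sign at one
  point decides its sign everywhere.\<close>

lemma Im_G_upper:
  assumes "Im w > 0"
  shows "Im (G w) < 0"
proof (rule ccontr)
  assume neg: "\<not> Im (G w) < 0"
  obtain v where v: "Im v > 0" "Im (G v) < 0" using Im_G_neg_somewhere by blast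
  have "connected ((Im \<circ> G) ` {w. Im w > 0})"
  proof (intro connected_continuous_image convex_connected convex_halfspace_Im_gt)
    have "{w. Im w > 0} \<subseteq> slit_plane lam" by (auto intro: slit_planeI)
    then have "continuous_on {w. Im w > 0} G"
      using holomorphic_on_imp_continuous_on holomorphic_on_subset hol_G by blast
    then show "continuous_on {w. Im w > 0} (Im \<circ> G)"
      unfolding o_def by (rule continuous_on_Im)
  qed
  from connectedD_interval[OF this, of "Im (G v)" "Im (G w)" 0]
  have "0 \<in> (Im \<circ> G) ` {w. Im w > 0}"
    using v assms neg by force
  then obtain z where "Im z > 0" "Im (G z) = 0" by auto
  then show False using Im_G_eq_0[of z] slit_planeI[of z] by auto
qed

lemma Im_G_lower:
  assumes "Im w < 0"
  shows "Im (G w) > 0"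
  using Im_G_upper[of "cnj w"] G_cnj[of w] assms slit_planeI[of w] by simp

lemma Im_G_iff:
  assumes "w \<in> slit_plane lam"
  shows "Im (G w) > 0 \<longleftrightarrow> Im w < 0" "Im (G w) < 0 \<longleftrightarrow> Im w > 0"
  using Im_G_upper[of w] Im_G_lower[of w] Im_G_eq_0[OF assms] by linarith+

section \<open>The functional equation on the slit plane\<close>

text \<open>The Cvitanovic-Feigenbaum equation read through \<open>G\<close>. Positivity of
  \<open>y\<close> is what makes \<open>y\<close> the principal root of
  \<open>G (- lam * x)\<close>.\<close>

lemma real_cf:
  assumes "- lam \<le> x" "x \<le> 1"
  obtains y where "0 < y" "y \<le> 1"
    "G (complex_of_real (- lam * x)) = complex_of_real (y ^ l)"
    "G (complex_of_real y) = of_real (lam ^ l) * G (complex_of_real x)"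
proof -
  obtain u where u: "u \<in> {0..1}" "\<phi> u = x" using \<phi>_surj assms by blast
  define t where "t = root l u"
  have t: "t \<in> {0..1}" "t ^ l = u" using u l by (auto simp: t_def)
  have ltl: "(lam * t) ^ l = lam ^ l * u" using t by (simp add: power_mult_distrib)
  have range: "lam ^ l * u \<in> {0..lam ^ l}" "lam ^ l * u \<in> {0..1}"
    using u lam by (auto simp: mult_left_le power_le_one mult_le_one)
  \<comment> \<open>With \<open>x = f t\<close>, this is \<open>y = f (lam * t)\<close>, so the
    equation says \<open>f y = - lam * x\<close>.\<close>
  define y where "y = \<phi> (lam ^ l * u)"
  have y: "0 < y" "y \<le> 1" 
    using \<phi>_pos[OF range(1)] \<phi>_le[OF range(2)] by (auto simp: y_def)
  have "\<phi> (y ^ l) = - lam * x" using cf[OF t(1)] by (simp add: ltl y_def t u)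
  then have "G (complex_of_real (- lam * x)) = complex_of_real (y ^ l)"
    using G_\<phi>[of "y ^ l"] y by (simp add: power_le_one)
  moreover have "G (complex_of_real y) = of_real (lam ^ l) * G (complex_of_real x)"
    using G_\<phi>[OF range(2)] G_\<phi>[OF u(1)] by (simp add: y_def u)
  ultimately show thesis using that y by blast
qed

text \<open>The real points of \<open>slit (- lam) 1\<close> lie in the range
  \<open>{- lam..1}\<close> of \<phi>, which is where \<open>real_cf\<close> applies.\<close>

lemma scaled_in_slit: 
  assumes "w \<in> slit (- lam) 1" 
  shows "- of_real lam * w \<in> slit_plane lam" "w \<in> slit_plane lam"
proof -
  have "\<bar>Re (- of_real lam * w)\<bar> \<le> 1" if "Im w = 0"
    using assms that lam by (auto simp: slit_def abs_mult intro!: mult_le_one)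
  then show "- of_real lam * w \<in> slit_plane lam"
    using assms lam by (intro slit_planeI) auto
  show "w \<in> slit_plane lam"
    using assms lam by (intro slit_planeI) (auto simp: slit_def)
qed

lemma slit_cases:
  assumes "w \<in> slit (- lam) 1"
  obtains "Im w \<noteq> 0" | x where "w = complex_of_real x" "- lam < x" "x < 1"
  using assms by (cases "Im w = 0") (auto simp: slit_def complex_eq_iff)

text \<open>\<open>G\<close> keeps non-real points non-real, and at a real point the value is some
  \<open>y ^ l > 0\<close>. So the branch cut of \<open>croot\<close> is avoided.\<close>

lemma G_scaled_notin_nonpos:
  assumes "w \<in> slit (- lam) 1"
  shows "G (- of_real lam * w) \<notin> \<real>\<^sub>\<le>\<^sub>0"
  using assms
proof (cases rule: slit_cases)
  case 1
  then have "Im (G (- of_real lam * w)) \<noteq> 0"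
    using Im_G_eq_0[OF scaled_in_slit(1)[OF assms]] lam by simp
  then show ?thesis by (auto simp: complex_nonpos_Reals_iff)
next
  case (2 x)
  then obtain y where "0 < y" "G (complex_of_real (- lam * x)) = complex_of_real (y ^ l)"
    using real_cf[of x] by auto
  moreover have "- of_real lam * w = complex_of_real (- lam * x)" using 2 by simp
  moreover have "0 < y ^ l" using \<open>0 < y\<close> by simp
  ultimately show ?thesis by (simp add: not_le del: of_real_power of_real_mult of_real_minus)
qed

text \<open>A real root has argument 0 or \<open>pi\<close>, so \<open>Arg z\<close> would be 0 or
  \<open>l * pi\<close>; the latter exceeds \<open>pi\<close> because
  \<open>l \<ge> 2\<close>.\<close>

lemma Im_croot:
  assumes "Im z \<noteq> 0"
  shows "Im (croot l z) \<noteq> 0"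
proof
  assume "Im (croot l z) = 0"
  then have "Arg (croot l z) = 0 \<or> Arg (croot l z) = pi"
    by (metis Arg_eq_0_pi complex_is_Real_iff)
  moreover have "z \<noteq> 0" using assms by auto
  ultimately have "Arg z = 0 \<or> Arg z = pi * real l"
    using l by (auto simp: Arg_croot field_simps)
  moreover have "pi * real l > pi" using l by simp
  ultimately have "Arg z = 0" using Arg_le_pi[of z] by linarith
  then show False using assms by (simp add: Arg_eq_0 complex_is_Real_iff)
qed

lemma croot_G_scaled_in_slit_plane:
  assumes "w \<in> slit (- lam) 1"
  shows "croot l (G (- of_real lam * w)) \<in> slit_plane lam"
  using assms
proof (cases rule: slit_cases)
  case 1
  then have "Im (G (- of_real lam * w)) \<noteq> 0"
    using Im_G_eq_0[OF scaled_in_slit(1)[OF assms]] lam by simp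
  then show ?thesis using Im_croot slit_planeI by blast
next
  case (2 x)
  then obtain y where "0 < y" "y \<le> 1" "G (complex_of_real (- lam * x)) = complex_of_real (y ^ l)"
    using real_cf[of x] by auto
  then show ?thesis using 2 l croot_of_real_power[of l y] by (auto intro!: slit_planeI)
qed

text \<open>The two preceding facts about \<open>G (- of_real lam * w)\<close> make the left-hand
  side holomorphic; the identity theorem then extends \<open>real_cf\<close> from the real
  segment.\<close>

lemma cf_identity:
  assumes "w \<in> slit (- lam) 1"
  shows "G (croot l (G (- of_real lam * w))) = of_real (lam ^ l) * G w"
proof -
  let ?S = "slit (- lam) 1"
  have inner: "(\<lambda>w. G (- of_real lam * w)) holomorphic_on ?S"
    using holomorphic_on_compose_gen[of "\<lambda>w. - of_real lam * w" ?S G, OF _ hol_G]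
      scaled_in_slit by (auto simp: o_def intro!: holomorphic_intros)
  have "(\<lambda>w. croot l (G (- of_real lam * w))) holomorphic_on ?S"
    by (intro holomorphic_on_croot inner G_scaled_notin_nonpos)
  then have "(\<lambda>w. G (croot l (G (- of_real lam * w)))) holomorphic_on ?S"
    using holomorphic_on_compose_gen[of _ ?S G, OF _ hol_G] croot_G_scaled_in_slit_plane
    by (auto simp: o_def)
  moreover have "G holomorphic_on ?S"
    using holomorphic_on_subset[OF hol_G] scaled_in_slit(2) by blast
  ultimately have hol: "(\<lambda>w. G (croot l (G (- of_real lam * w))) - of_real (lam ^ l) * G w) holomorphic_on ?S"
    by (intro holomorphic_intros)
  have "0 islimpt {- lam<..<1}"
    using lam by (intro open_imp_islimpt) auto
  then have lim: "complex_of_real 0 islimpt complex_of_real ` {- lam<..<1}"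
    by (rule islimpt_isCont_image)
       (auto simp: eventually_at_filter intro!: continuous_intros)
  have "G (croot l (G (- of_real lam * w))) - of_real (lam ^ l) * G w = 0"
  proof (rule analytic_continuation[OF hol open_slit connected_slit _ _ lim])
    show "complex_of_real ` {- lam<..<1} \<subseteq> ?S" by (auto simp: slit_def)
    fix z assume "z \<in> complex_of_real ` {- lam<..<1}"
    then obtain x where x: "- lam < x" "x < 1" "z = complex_of_real x" by auto
    obtain y where "0 < y" "G (complex_of_real (- lam * x)) = complex_of_real (y ^ l)"
      "G (complex_of_real y) = of_real (lam ^ l) * G (complex_of_real x)"
      using real_cf[of x] x by auto
    then show "G (croot l (G (- of_real lam * z))) - of_real (lam ^ l) * G z = 0"
      using x l croot_of_real_power[of l y] by simp
  qed (use assms lam in \<open>auto simp: slit_def\<close>)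
  then show ?thesis by simp
qed

section \<open>The conjugacy and the exchange of the two sectors\<close>

lemma map_F_G: "w \<in> slit_plane lam \<Longrightarrow> map_F lam G (G w) = w"
  unfolding map_F_def by (rule inv_into_f_f[OF inj_G])

text \<open>By \<open>cf_identity\<close>, \<open>(lam * z) ^ l\<close> is \<open>G\<close> of the
  stated root, and \<open>F\<close> undoes \<open>G\<close>. Since \<open>f\<close> sees only the
  power, any \<open>l\<close>-th root \<open>z\<close> of \<open>G w\<close> is allowed.\<close>

lemma map_f_scaled_eq:
  assumes "w \<in> slit (- lam) 1" "z ^ l = G w"
  shows "of_real lam * z \<in> dom_W l lam G"
    "map_f_scaled l lam G z = croot l (G (- of_real lam * w))"
proof -
  let ?v = "croot l (G (- of_real lam * w))"
  have eq: "(of_real lam * z) ^ l = G ?v"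
    using cf_identity[OF assms(1)] assms(2) by (simp add: power_mult_distrib)
  have v: "?v \<in> slit_plane lam" by (rule croot_G_scaled_in_slit_plane[OF assms(1)])
  show "of_real lam * z \<in> dom_W l lam G"
    using v by (auto simp: dom_W_def calW_def eq)
  show "map_f_scaled l lam G z = ?v"
    unfolding map_f_scaled_def map_f_def eq by (rule map_F_G[OF v])
qed

lemma dom_W_E:
  assumes "z \<in> dom_W l lam G"
  obtains w where "w \<in> slit_plane lam" "z ^ l = G w"
  using assms by (auto simp: dom_W_def calW_def)

text \<open>For arguments in \<open>(0, pi/l)\<close> the power map is inverted by
  \<open>croot l\<close> and lands in the upper half-plane, whose points in the image of
  \<open>G\<close> come exactly from the lower one.\<close>

lemma W_plus_eq: "W_plus l lam G = (\<lambda>w. croot l (G w)) ` {w. Im w < 0}"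
proof (intro equalityI subsetI)
  fix z assume z: "z \<in> W_plus l lam G"
  then obtain w where w: "w \<in> slit_plane lam" "z ^ l = G w"
    by (auto simp: W_plus_def elim: dom_W_E)
  have arg: "0 < Arg z" "Arg z < pi / real l" "z \<noteq> 0"
    using z by (auto simp: W_plus_def Arg_zero)
  then have "Arg (z ^ l) = real l * Arg z" "croot l (z ^ l) = z"
    using l power_in_sector[of l z] by auto
  moreover from this have "Im (z ^ l) > 0"
    using arg l Arg_lt_pi[of "z ^ l"] by (simp add: field_simps)
  ultimately show "z \<in> (\<lambda>w. croot l (G w)) ` {w. Im w < 0}"
    using w Im_G_iff[OF w(1)] by force
next
  fix z assume "z \<in> (\<lambda>w. croot l (G w)) ` {w. Im w < 0}"
  then obtain w where w: "Im w < 0" "z = croot l (G w)" by auto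
  have G: "Im (G w) > 0" "G w \<noteq> 0" using Im_G_lower[OF w(1)] by auto
  have wS: "w \<in> slit_plane lam" using w by (auto intro: slit_planeI)
  have "z ^ l = G w" using w G l croot_power by simp
  then show "z \<in> W_plus l lam G"
    using w G l wS Arg_lt_pi[of "G w"]
    by (auto simp: W_plus_def dom_W_def calW_def Arg_croot divide_strict_right_mono)
qed

lemma W_minus_eq: "W_minus l lam G = (\<lambda>w. croot l (G w)) ` {w. Im w > 0}"
proof (intro equalityI subsetI)
  fix z assume z: "z \<in> W_minus l lam G"
  then obtain w where w: "w \<in> slit_plane lam" "z ^ l = G w"
    by (auto simp: W_minus_def elim: dom_W_E)
  have arg: "Arg z < 0" "- (pi / real l) < Arg z" "z \<noteq> 0"
    using z by (auto simp: W_minus_def Arg_zero)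
  then have "Arg (z ^ l) = real l * Arg z" "croot l (z ^ l) = z"
    using l power_in_sector[of l z] by auto
  moreover from this have "Im (z ^ l) < 0"
    using arg l Arg_neg_iff[of "z ^ l"] by (simp add: mult_pos_neg)
  ultimately show "z \<in> (\<lambda>w. croot l (G w)) ` {w. Im w > 0}"
    using w Im_G_iff[OF w(1)] by force
next
  fix z assume "z \<in> (\<lambda>w. croot l (G w)) ` {w. Im w > 0}"
  then obtain w where w: "Im w > 0" "z = croot l (G w)" by auto
  have G: "Im (G w) < 0" "G w \<noteq> 0" using Im_G_upper[OF w(1)] by auto
  have wS: "w \<in> slit_plane lam" using w by (auto intro: slit_planeI)
  have "z ^ l = G w" using w G l croot_power by simp
  moreover have "- pi / real l < Arg (G w) / real l"
    using l Arg_bounded[of "G w"] by (intro divide_strict_right_mono) auto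
  moreover have "Arg (G w) < 0" using G Arg_neg_iff by blast
  ultimately show "z \<in> W_minus l lam G"
    using w G l wS
    by (auto simp: W_minus_def dom_W_def calW_def Arg_croot divide_neg_pos)
qed

lemma map_f_scaled_croot:
  assumes "Im w \<noteq> 0"
  shows "of_real lam * croot l (G w) \<in> dom_W l lam G"
    "map_f_scaled l lam G (croot l (G w)) = croot l (G (- of_real lam * w))"
proof -
  have "Im (G w) \<noteq> 0" using assms Im_G_eq_0[of w] slit_planeI[of w] by auto
  then have "croot l (G w) ^ l = G w" using l by (intro croot_power) auto
  moreover have "w \<in> slit (- lam) 1" using assms by (simp add: slit_def)
  ultimately show "of_real lam * croot l (G w) \<in> dom_W l lam G"
    "map_f_scaled l lam G (croot l (G w)) = croot l (G (- of_real lam * w))"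
    using map_f_scaled_eq by blast+
qed

lemma scaled_in_dom_W:
  assumes "z \<in> W_plus l lam G \<union> W_minus l lam G"
  shows "of_real lam * z \<in> dom_W l lam G"
  using assms map_f_scaled_croot(1) by (auto simp: W_plus_eq W_minus_eq)

lemma scale_halfplanes:
  "(\<lambda>w. - of_real lam * w) ` {w. Im w < 0} = {w. Im w > 0}"
  "(\<lambda>w. - of_real lam * w) ` {w. Im w > 0} = {w. Im w < 0}"
proof -
  have "(\<lambda>w. - of_real lam * w) ` {w. P (Im w)} = {w. P (- Im w / lam)}" for P
  proof (intro equalityI subsetI)
    fix w assume "w \<in> {w. P (- Im w / lam)}"
    then show "w \<in> (\<lambda>w. - of_real lam * w) ` {w. P (Im w)}"
      using lam by (intro image_eqI[of _ _ "- w / of_real lam"]) auto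
  qed (use lam in auto)
  from this[of "\<lambda>y. y < 0"] this[of "\<lambda>y. y > 0"]
  show "(\<lambda>w. - of_real lam * w) ` {w. Im w < 0} = {w. Im w > 0}"
    "(\<lambda>w. - of_real lam * w) ` {w. Im w > 0} = {w. Im w < 0}"
    using lam by (simp_all add: divide_less_0_iff zero_less_divide_iff)
qed

text \<open>Through the parametrization by \<open>croot l (G w)\<close> the scaled map becomes
  \<open>w \<mapsto> - lam * w\<close>, which swaps the half-planes.\<close>

lemma exchange:
  "map_f_scaled l lam G ` W_plus l lam G = W_minus l lam G"
  "map_f_scaled l lam G ` W_minus l lam G = W_plus l lam G"
proof -
  have image: "map_f_scaled l lam G ` (\<lambda>w. croot l (G w)) ` A
      = (\<lambda>w. croot l (G w)) ` (\<lambda>w. - of_real lam * w) ` A" if "\<And>w. w \<in> A \<Longrightarrow> Im w \<noteq> 0" for A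
    unfolding image_image using that map_f_scaled_croot(2) by (intro image_cong) auto
  show "map_f_scaled l lam G ` W_plus l lam G = W_minus l lam G"
    "map_f_scaled l lam G ` W_minus l lam G = W_plus l lam G"
    using image[of "{w. Im w < 0}"] image[of "{w. Im w > 0}"]
    unfolding W_plus_eq W_minus_eq scale_halfplanes by auto
qed

section \<open>The fixed point and its multiplier\<close>

lemma calW_open: "open (calW lam G)"
  unfolding calW_def by (rule open_mapping_thm3[OF hol_G open_slit_plane inj_G])

lemma hol_map_F: "map_F lam G holomorphic_on calW lam G"
proof -
  obtain F where F: "F holomorphic_on G ` slit_plane lam" "\<And>w. w \<in> slit_plane lam \<Longrightarrow> F (G w) = w"
    using holomorphic_has_inverse[OF hol_G open_slit_plane inj_G] by metis
  show ?thesis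
    unfolding calW_def by (rule holomorphic_transform[OF F(1)]) (auto simp: F(2) map_F_G)
qed

lemma dom_W_open: "open (dom_W l lam G)"
proof -
  have "dom_W l lam G = (\<lambda>z. z ^ l) -` calW lam G" by (auto simp: dom_W_def)
  then show ?thesis
    by (simp only:) (intro open_vimage calW_open continuous_intros)
qed

lemma hol_map_f: "map_f l lam G holomorphic_on dom_W l lam G"
proof -
  have "(map_F lam G \<circ> (\<lambda>z. z ^ l)) holomorphic_on dom_W l lam G"
    by (rule holomorphic_on_compose_gen[OF _ hol_map_F])
       (auto simp: dom_W_def intro!: holomorphic_intros)
  then show ?thesis
    by (simp add: o_def map_f_def[abs_def])
qed

text \<open>Injectivity of \<open>G\<close> turns \<open>f x = 0\<close> into
  \<open>x ^ l = u\<close> with \<open>u = G 0\<close> in \<open>(0, 1)\<close>. This has exactly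
  one positive solution, so the \<open>LEAST\<close> in \<open>first_zero\<close> is attained, at
  \<open>root l u\<close>.\<close>

lemma first_zero:
  defines "x0 \<equiv> first_zero l lam G"
  shows "0 < x0" "complex_of_real x0 ^ l = G 0"
proof -
  obtain u where u: "u \<in> {0..1}" "\<phi> u = 0"
    using \<phi>_surj[of 0] lam by auto
  then have u01: "0 < u" "u < 1" using \<phi>_0 \<phi>_1 lam by (auto simp: less_le)
  have Gu: "G 0 = of_real u" using G_\<phi>[OF u(1)] u by simp
  have 0: "0 \<in> slit_plane lam" by (rule slit_planeI) simp
  have iff: "complex_of_real x \<in> dom_W l lam G \<and> map_f l lam G (complex_of_real x) = 0
      \<longleftrightarrow> x ^ l = u" for x
  proof
    assume "complex_of_real x \<in> dom_W l lam G \<and> map_f l lam G (complex_of_real x) = 0"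
    then have "complex_of_real x ^ l = G 0"
      by (auto elim!: dom_W_E simp: map_f_def map_F_G)
    then show "x ^ l = u"
      unfolding Gu by (metis of_real_eq_iff of_real_power)
  next
    assume "x ^ l = u"
    then have "complex_of_real x ^ l = G 0" by (metis Gu of_real_power)
    then show "complex_of_real x \<in> dom_W l lam G \<and> map_f l lam G (complex_of_real x) = 0"
      using 0 by (auto simp: dom_W_def calW_def map_f_def map_F_G)
  qed
  have "x0 = root l u"
    unfolding x0_def first_zero_def iff
    by (rule Least_equality) (use u01 l real_root_pos_unique[of l] in \<open>auto simp: order.order_iff_strict\<close>)
  then show "0 < x0" "complex_of_real x0 ^ l = G 0"
    using u01 l Gu by (auto simp flip: of_real_power)
qed

text \<open>Near the fixed point, \<psi> is a left inverse of \<open>f\<close> and the scaled map is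
  \<open>\<psi> (- lam * f z)\<close>. The chain rule gives the multiplier \<open>- lam\<close>
  times the product of the derivatives of \<psi> and \<open>f\<close>, and that product is
  1.\<close>

lemma attracting:
  defines "x0 \<equiv> first_zero l lam G"
  shows "attracting_fixed_point (map_f_scaled l lam G) (complex_of_real x0) (- of_real lam)"
proof -
  let ?x = "complex_of_real x0" and ?f = "map_f l lam G" and ?\<psi> = "\<lambda>w. croot l (G w)"
  have x0: "0 < x0" "?x ^ l = G 0" 
    using first_zero by (auto simp: x0_def)
  have 0: "0 \<in> slit (- lam) 1" "0 \<in> slit_plane lam" using lam by (auto simp: slit_def intro: slit_planeI)
  have x_dom: "?x \<in> dom_W l lam G" using x0 0 by (auto simp: dom_W_def calW_def)
  have fx: "?f ?x = 0" using x0 0 by (simp add: map_f_def map_F_G)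
  have lx_dom: "of_real lam * ?x \<in> dom_W l lam G" by (rule map_f_scaled_eq(1)[OF 0(1) x0(2)])
  have \<psi>0: "?\<psi> 0 = ?x"
    using x0 croot_of_real_power[of l x0] l by (metis of_real_power gr_zeroI not_numeral_le_zero)
  have fix_x: "map_f_scaled l lam G ?x = ?x"
    using map_f_scaled_eq(2)[OF 0(1) x0(2)] \<psi>0 by simp
  have an: "map_f_scaled l lam G analytic_on {?x}"
    unfolding analytic_at
  proof (intro exI conjI)
    let ?S = "(\<lambda>z. of_real lam * z) -` dom_W l lam G"
    show "open ?S" by (rule open_vimage[OF dom_W_open]) (intro continuous_intros)
    show "?x \<in> ?S" using lx_dom by simp
    show "map_f_scaled l lam G holomorphic_on ?S"
      using holomorphic_on_compose_gen[of "\<lambda>z. of_real lam * z" ?S, OF _ hol_map_f]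
      by (auto simp: o_def map_f_scaled_def[abs_def] intro!: holomorphic_intros)
  qed
  have f': "(?f has_field_derivative deriv ?f ?x) (at ?x)"
    using holomorphic_derivI[OF hol_map_f dom_W_open x_dom] .
  have "G 0 \<notin> \<real>\<^sub>\<le>\<^sub>0" using x0 by (metis G_scaled_notin_nonpos 0(1) mult_zero_right)
  then have "(\<lambda>w. croot l w) holomorphic_on - \<real>\<^sub>\<le>\<^sub>0" "G 0 \<in> - \<real>\<^sub>\<le>\<^sub>0"
    by (auto intro!: holomorphic_intros)
  then have "croot l field_differentiable at (G 0)"
    by (metis closed_nonpos_Reals_complex holomorphic_on_imp_differentiable_at open_Compl)
  moreover have "G field_differentiable at 0"
    using hol_G open_slit_plane 0(2) holomorphic_on_imp_differentiable_at by blast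
  ultimately have "?\<psi> field_differentiable at 0"
    using field_differentiable_compose by (auto simp: o_def)
  then obtain p where p: "(?\<psi> has_field_derivative p) (at 0)"
    by (auto simp: field_differentiable_def)
  \<comment> \<open>Two open conditions hold at the fixed point: \<open>f z\<close> lies in
    \<open>slit (- lam) 1\<close>, so the conjugacy applies, and \<open>z\<close> lies in the sector
    where \<open>croot l\<close> undoes the power.\<close>
  have near: "\<forall>\<^sub>F z in nhds ?x. ?\<psi> (?f z) = z \<and> map_f_scaled l lam G z = ?\<psi> (- of_real lam * ?f z)"
  proof -
    have "open (dom_W l lam G \<inter> ?f -` slit (- lam) 1)"
      by (intro continuous_open_preimage holomorphic_on_imp_continuous_on hol_map_f dom_W_open open_slit)
    then have "\<forall>\<^sub>F z in nhds ?x. z \<in> dom_W l lam G \<inter> ?f -` slit (- lam) 1"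
      by (rule eventually_nhds_in_open) (use x_dom fx 0 in simp)
    moreover have "open (- \<real>\<^sub>\<le>\<^sub>0 \<inter> Arg -` {- (pi / real l)<..<pi / real l})"
      by (intro continuous_open_preimage continuous_at_imp_continuous_on ballI continuous_at_Arg)
         (auto intro: open_Compl)
    then have "\<forall>\<^sub>F z in nhds ?x. z \<in> - \<real>\<^sub>\<le>\<^sub>0 \<inter> Arg -` {- (pi / real l)<..<pi / real l}"
      by (rule eventually_nhds_in_open) (use x0 l in \<open>auto simp: Arg_eq_0[THEN iffD2]\<close>)
    moreover have "\<forall>\<^sub>F z in nhds ?x. z \<noteq> 0"
      using x0 by (intro t1_space_nhds) auto
    ultimately show ?thesis
    proof eventually_elim
      case (elim z)
      then obtain w where w: "w \<in> slit_plane lam" "z ^ l = G w" by (auto elim: dom_W_E)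
      have "\<bar>Arg z\<bar> < pi / real l" using elim by auto
      moreover have fz: "?f z = w" using w by (simp add: map_f_def map_F_G)
      ultimately show ?case
        using w elim power_in_sector(1)[of l z] l map_f_scaled_eq(2)[of w z] by auto
    qed
  qed
  have p1: "((\<lambda>z. ?\<psi> (?f z)) has_field_derivative p * deriv ?f ?x) (at ?x)"
    by (rule DERIV_chain2[of ?\<psi> p ?f]) (use p f' fx in auto)
  have "((\<lambda>z. z) has_field_derivative p * deriv ?f ?x) (at ?x)"
    by (subst DERIV_cong_ev[OF refl _ refl, of _ "\<lambda>z. ?\<psi> (?f z)"])
       (use near p1 in \<open>auto elim: eventually_mono\<close>)
  then have one: "p * deriv ?f ?x = 1"
    using DERIV_unique DERIV_ident by blast
  have p2: "((\<lambda>z. ?\<psi> (- of_real lam * ?f z)) has_field_derivative p * (- of_real lam * deriv ?f ?x)) (at ?x)"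
    by (rule DERIV_chain2[of ?\<psi> p]) (use p f' fx in \<open>auto intro!: derivative_eq_intros\<close>)
  have "(map_f_scaled l lam G has_field_derivative p * (- of_real lam * deriv ?f ?x)) (at ?x)"
    by (subst DERIV_cong_ev[OF refl _ refl, of _ "\<lambda>z. ?\<psi> (- of_real lam * ?f z)"])
       (use near p2 in \<open>auto elim: eventually_mono\<close>)
  then have "deriv (map_f_scaled l lam G) ?x = - of_real lam * (p * deriv ?f ?x)"
    by (simp add: DERIV_imp_deriv)
  then show ?thesis
    using an fix_x one lam by (simp add: attracting_fixed_point_def)
qed

end

section \<open>From the renormalization fixed point to the inverse of \<open>F\<close>\<close>

text \<open>The factor \<phi> with \<open>g x = \<phi> (x ^ l)\<close> serves; the substitution
  \<open>x = root l u\<close> carries the properties of \<open>g\<close> over to it.\<close>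

lemma pd_fixed_point_imp_cf_inverse:
  fixes g :: "real \<Rightarrow> real"
  assumes l: "even l" "l \<ge> 2"
    and fp: "pd_fixed_point l g"
    and lam_def: "lam = pd_scale g"
    and univ: "univalent_on Finv (slit_plane lam)"
    and ext: "extends_near_0 l lam Finv g"
  obtains \<phi> where "cf_inverse l lam \<phi> Finv"
proof -
  have "unimodal_degree l g" using fp by (simp add: pd_fixed_point_def)
  then obtain \<phi> where g0: "g 0 = 1" and gim: "g ` {-1..1} \<subseteq> {-1..1}"
    and an: "real_analytic_on \<phi> {0..1}" and neg: "\<And>u. u \<in> {0..1} \<Longrightarrow> deriv \<phi> u < 0"
    and g\<phi>: "\<And>x. x \<in> {-1..1} \<Longrightarrow> g x = \<phi> (x ^ l)"
    unfolding unimodal_degree_def by blast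
  have lam: "0 < lam" "lam < 1" and disj: "g ` {- lam..lam} \<inter> {- lam..lam} = {}"
    using fp by (auto simp: pd_fixed_point_def pd_renormalizable_def Let_def lam_def)
  have g\<phi>_root: "\<phi> u = g (root l u)" "root l u \<in> {0..1}" if "u \<in> {0..1}" for u
  proof -
    show "root l u \<in> {0..1}" using that l by (auto simp: real_root_le_1_iff)
    then have "root l u \<in> {-1..1}" by (auto intro: order_trans[of _ 0])
    then show "\<phi> u = g (root l u)" using that l g\<phi>[of "root l u"] by simp
  qed
  have \<phi>0: "\<phi> 0 = 1" using g\<phi>[of 0] g0 l by (simp add: power_0_left)
  have cont: "continuous_on {0..1} \<phi>"
    using real_analytic_on_imp_DERIV[OF an]
    by (meson DERIV_continuous continuous_at_imp_continuous_on)
  show thesis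
  proof (rule that, unfold_locales)
    show "\<phi> 1 = - lam" using g\<phi>[of 1] g0 by (simp add: lam_def pd_scale_def)
    show "\<bar>\<phi> u\<bar> \<le> 1" if "u \<in> {0..1}" for u
    proof -
      have "root l u \<in> {-1..1}" using g\<phi>_root(2)[OF that] by auto
      then have "g (root l u) \<in> {-1..1}" using gim by blast
      then show ?thesis using g\<phi>_root(1)[OF that] by auto
    qed
    show "0 < \<phi> u" if u: "u \<in> {0..lam ^ l}" for u
    \<comment> \<open>Otherwise \<phi>, starting from 1, takes the value \<open>lam\<close> at some
      \<open>v \<le> lam ^ l\<close>. Then \<open>g\<close> sends the point \<open>root l v\<close>
      of \<open>{- lam..lam}\<close> to \<open>lam\<close>, against the disjointness of this
      interval from its image.\<close>
    proof (rule ccontr)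
      assume "\<not> 0 < \<phi> u"
      moreover have u1: "u \<le> 1" using u lam power_le_one[of lam l] by auto
      ultimately obtain v where v: "0 \<le> v" "v \<le> u" "\<phi> v = lam"
        using IVT2'[of \<phi> u lam 0] \<phi>0 lam u continuous_on_subset[OF cont, of "{0..u}"] by auto
      have "root l v \<le> root l (lam ^ l)" using v u l by (intro real_root_le_mono) auto
      then have "root l v \<in> {- lam..lam}"
        using lam v l by (auto simp: real_root_power_cancel intro: order_trans[of _ 0])
      moreover have "g (root l v) = lam" using g\<phi>_root(1)[of v] v u1 by auto
      ultimately show False using disj lam by force
    qed
    show "\<phi> (\<phi> ((lam * x) ^ l) ^ l) = - lam * \<phi> (x ^ l)" if x: "x \<in> {0..1}" for x
    proof -
      have lx: "lam * x \<in> {-1..1}"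
        using x lam by (auto simp: mult_le_one intro: order_trans[of _ 0])
      then have "g (lam * x) \<in> {-1..1}" using gim by blast
      then have "g (g (lam * x)) = \<phi> (\<phi> ((lam * x) ^ l) ^ l)"
        using g\<phi> lx by simp
      moreover have "- (1 / lam) * g (g (lam * x)) = g x"
        using fp x unfolding pd_fixed_point_def pd_renormalization_def lam_def by auto
      ultimately show ?thesis using g\<phi>[of x] x lam by (simp add: field_simps)
    qed
    obtain e where e: "e > 0" "\<And>x. \<bar>x\<bar> < e \<Longrightarrow> complex_of_real x \<in> dom_W l lam Finv \<and>
        map_f l lam Finv (complex_of_real x) = complex_of_real (g x)"
      using ext unfolding extends_near_0_def by (auto simp: eventually_nhds_metric dist_real_def)
    \<comment> \<open>Below \<open>e ^ l\<close> the root of \<open>u\<close> lies where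
      \<open>f\<close> and \<open>g\<close> agree; below 1 one has
      \<open>\<phi> u = g (root l u)\<close>.\<close>
    have "\<forall>\<^sub>F u in at_right 0. u \<in> {0<..<min 1 (e ^ l)}"
      using e by (intro eventually_at_right_real) auto
    then show "\<forall>\<^sub>F u in at_right 0. Finv (complex_of_real (\<phi> u)) = complex_of_real u"
    proof eventually_elim
      case (elim u)
      let ?x = "root l u"
      have "?x < root l (e ^ l)" using elim l by (intro real_root_less_mono) auto
      then have x: "\<bar>?x\<bar> < e" using elim e l by (simp add: real_root_power_cancel)
      have xl: "complex_of_real ?x ^ l = complex_of_real u"
        using elim l by (simp flip: of_real_power)
      then have "complex_of_real u \<in> Finv ` slit_plane lam"
        "map_F lam Finv (complex_of_real u) = complex_of_real (\<phi> u)"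
        using e(2)[OF x] elim g\<phi>_root(1)[of u] by (auto simp: dom_W_def calW_def map_f_def)
      then show ?case
        \<comment> \<open>As \<open>u\<close> is in the image of \<open>Finv\<close>, applying
          \<open>Finv\<close> to \<open>F u = \<phi> u\<close> returns \<open>u\<close>.\<close>
        unfolding map_F_def by (metis f_inv_into_f)
    qed
  qed (use l lam univ an neg \<phi>0 in auto)
qed

theorem lemma1:
  fixes l :: nat and g :: "real \<Rightarrow> real" and lam x0 :: real and Finv :: "complex \<Rightarrow> complex"
  assumes "even l" and "l \<ge> 2"
    and "pd_fixed_point l g"
    and "lam = pd_scale g"
    and "univalent_on Finv (slit_plane lam)"
    and "extends_near_0 l lam Finv g"
    and "x0 = first_zero l lam Finv"
  shows "0 < x0 \<and> complex_of_real x0 \<in> dom_W l lam Finv \<and>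
         map_f l lam Finv (complex_of_real x0) = 0 \<and>
         complex_of_real (lam * x0) \<in> dom_W l lam Finv \<and>
         attracting_fixed_point (map_f_scaled l lam Finv) (complex_of_real x0)
           (- complex_of_real lam) \<and>
         (\<forall>z \<in> W_plus l lam Finv \<union> W_minus l lam Finv.
            complex_of_real lam * z \<in> dom_W l lam Finv) \<and>
         map_f_scaled l lam Finv ` W_plus l lam Finv = W_minus l lam Finv \<and>
         map_f_scaled l lam Finv ` W_minus l lam Finv = W_plus l lam Finv"
proof -
  obtain \<phi> where "cf_inverse l lam \<phi> Finv"
    using pd_fixed_point_imp_cf_inverse[OF assms(1-6)] .
  then interpret cf_inverse l lam \<phi> Finv .
  have x0: "0 < x0" "complex_of_real x0 ^ l = Finv 0"
    using first_zero by (auto simp: assms(7))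
  have 0: "0 \<in> slit_plane lam" "0 \<in> slit (- lam) 1"
    using lam by (auto simp: slit_def intro: slit_planeI)
  have "complex_of_real x0 \<in> dom_W l lam Finv" "map_f l lam Finv (complex_of_real x0) = 0"
    using x0 0 by (auto simp: dom_W_def calW_def map_f_def map_F_G)
  moreover have "complex_of_real (lam * x0) \<in> dom_W l lam Finv"
    using map_f_scaled_eq(1)[OF 0(2) x0(2)] by simp
  ultimately show ?thesis
    using x0 attracting exchange scaled_in_dom_W by (simp add: assms(7))
qed

end
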